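(* Let $\mathbb{M}^3=(\mathbb{R}^3,\|\cdot\|)$ be a Minkowski space whose unit ball $\mathbb{B}$ is a $3$-dimensional cross-polytope, and let $K\in\mathcal{K}^3$. Then $$D(K)\le 2R(K),\qquad r(K)+R(K)\le D(K),\qquad\text{and}\qquad 2\,(R(K)-r(K))\le D(K).$$ Moreover, these three inequalities form a complete system of inequalities for the inradius, diameter and circumradius in $\mathbb{M}^3$: for every triple $(r,D,R)$ of real numbers with $D\le 2R$, $r+R\le D$ and $2(R-r)\le D$ there exists $K\in\mathcal{K}^3$ with $r(K)=r$, $D(K)=D$ and $R(K)=R$.
   Context: $\mathcal{K}^3$ denotes the set of convex bodies in $\mathbb{R}^3$, i.e. non-empty, convex, compact sets (possibly with empty interior). A Minkowski space is $\mathbb{R}^3$ with a norm $\|\cdot\|$; its unit ball is $\mathbb{B}=\{x:\|x\|\le 1\}$. For $K\in\mathcal{K}^3$: circumradius $R(K)=\inf\{\rho\ge 0:K\subset c+\rho\mathbb{B},\ c\in\mathbb{R}^3\}$; inradius $r(K)=\sup\{\rho\ge 0: c+\rho\mathbb{B}\subset K,\ c\in\mathbb{R}^3\}$; diameter $D(K)=\max_{x,y\in K}\|x-y\|$. A $3$-dimensional cross-polytope is the image of $\mathrm{conv}\{\pm u^1,\pm u^2,\pm u^3\}$ under a non-singular affine map, where $u^1,u^2,u^3$ is the canonical basis. *)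

theory Defs
  imports "HOL-Analysis.Analysis"
begin

text \<open>The norm of a Minkowski space is an arbitrary function on the Euclidean space
  \<open>real^'n\<close>, in general different from the norm of the type class.\<close>

definition is_norm :: "('a::real_vector \<Rightarrow> real) \<Rightarrow> bool" where
  "is_norm N \<longleftrightarrow>
     (\<forall>x. N x \<ge> 0) \<and>
     (\<forall>x. N x = 0 \<longleftrightarrow> x = 0) \<and>
     (\<forall>a x. N (a *\<^sub>R x) = \<bar>a\<bar> * N x) \<and>
     (\<forall>x y. N (x + y) \<le> N x + N y)"

definition unit_ball :: "('a \<Rightarrow> real) \<Rightarrow> 'a set" where
  "unit_ball N = {x. N x \<le> 1}"

definition scaled_ball :: "('a::real_vector \<Rightarrow> real) \<Rightarrow> 'a \<Rightarrow> real \<Rightarrow> 'a set" where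
  "scaled_ball N c \<rho> = (\<lambda>x. c + \<rho> *\<^sub>R x) ` unit_ball N"

text \<open>All norms on a finite-dimensional space induce the Euclidean topology, so compactness
  may be taken with respect to the topology of the type.\<close>

definition convex_body :: "'a::euclidean_space set \<Rightarrow> bool" where
  "convex_body K \<longleftrightarrow> K \<noteq> {} \<and> convex K \<and> compact K"

definition circumradius :: "('a::real_vector \<Rightarrow> real) \<Rightarrow> 'a set \<Rightarrow> real" where
  "circumradius N K = Inf {\<rho>. \<rho> \<ge> 0 \<and> (\<exists>c. K \<subseteq> scaled_ball N c \<rho>)}"

definition inradius :: "('a::real_vector \<Rightarrow> real) \<Rightarrow> 'a set \<Rightarrow> real" where
  "inradius N K = Sup {\<rho>. \<rho> \<ge> 0 \<and> (\<exists>c. scaled_ball N c \<rho> \<subseteq> K)}"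

text \<open>For a convex body the supremum is attained by compactness, hence is the maximum.\<close>

definition norm_diameter :: "('a::real_vector \<Rightarrow> real) \<Rightarrow> 'a set \<Rightarrow> real" where
  "norm_diameter N K = Sup {N (x - y) | x y. x \<in> K \<and> y \<in> K}"

definition std_cross_polytope :: "(real^'n) set" where
  "std_cross_polytope = convex hull (\<Union>i. {axis i 1, - axis i 1})"

definition is_cross_polytope :: "(real^'n) set \<Rightarrow> bool" where
  "is_cross_polytope P \<longleftrightarrow>
     (\<exists>(A :: real^'n^'n) b. invertible A \<and> P = (\<lambda>x. A *v x + b) ` std_cross_polytope)"

end

theory Submission
  imports Defs
begin

text \<open>The eight facets of an octahedron \<open>B\<close> come in four opposite pairs, so
  \<open>N x = max\<^sub>i \<bar>v\<^sub>i x\<bar>\<close> for four functionals whose only linear relation is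
  \<open>v\<^sub>1 + v\<^sub>2 + v\<^sub>3 + v\<^sub>4 = 0\<close>. Hence the circumradius is at most the largest of \<open>D / 2\<close>,
  \<open>(\<Sum>\<^sub>i max\<^sub>K v\<^sub>i) / 4\<close> and \<open>-(\<Sum>\<^sub>i min\<^sub>K v\<^sub>i) / 4\<close>, and for \<open>R - r \<le> D / 2\<close> it remains to
  inscribe a ball of radius \<open>\<rho> = (\<Sum>\<^sub>i max\<^sub>K v\<^sub>i) / 4 - D / 2\<close>. If \<open>p\<^sub>j\<close> maximises \<open>v\<^sub>j\<close> on \<open>K\<close>, the
  matrix \<open>v\<^sub>i p\<^sub>j - v\<^sub>i p\<^sub>i + D\<close> equals \<open>D (I + E)\<close> with \<open>E \<ge> 0\<close> and all column sums equal to
  \<open>\<epsilon> = 1 - 4 \<rho> / D < 1\<close>. Writing \<open>(I + E)\<^sup>-\<^sup>1 = Q (I - E)\<close> with \<open>Q = (I - E\<^sup>2)\<^sup>-\<^sup>1 \<ge> 0\<close>, the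
  nonnegative weights proportional to \<open>Q (u + E (1 - u))\<close>, where \<open>u = (1 + v x) / 2\<close>, exhibit every
  \<open>c + \<rho> x\<close> with \<open>x \<in> B\<close> as a convex combination of the \<open>p\<^sub>j\<close>.

  All triples are realised by \<open>a T + b B + c [-s, s]\<close>, where the tetrahedron \<open>T\<close> is the intersection
  of four of the half-spaces defining \<open>B\<close> and \<open>s\<close> is a vertex of \<open>B\<close>; the three summands have
  \<open>(r, D, R)\<close> equal to \<open>(1, 4, 3)\<close>, \<open>(1, 2, 1)\<close> and \<open>(0, 2, 1)\<close>, and all three functionals are
  additive on these sums.\<close>

section \<open>Nonnegative matrices with constant column sum below one\<close>

text \<open>The negative part \<open>n\<close> of \<open>h\<close> satisfies n \<le> F n entrywise;
  adding the entries gives sum n \<le> q * sum n, so n = 0. In other words, the inverse of I - F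
  preserves nonnegativity.\<close>

lemma nonneg_of_ge_matrix_mult:
  fixes F :: "real^'n^'n"
  assumes F: "\<And>i j. 0 \<le> F $ i $ j" and q: "\<And>j. (\<Sum>i\<in>UNIV. F $ i $ j) = q" "q < 1"
    and h: "\<And>i. (F *v h) $ i \<le> h $ i"
  shows "0 \<le> h $ i"
proof -
  define n where "n i = max 0 (- h $ i)" for i
  have n0: "0 \<le> n i" for i by (simp add: n_def)
  have le: "n i \<le> (\<Sum>j\<in>UNIV. F $ i $ j * n j)" for i
  proof -
    have "- h $ i \<le> - (F *v h) $ i" using h by simp
    also have "\<dots> = (\<Sum>j\<in>UNIV. F $ i $ j * (- h $ j))"
      by (simp add: matrix_vector_mult_def sum_negf)
    also have "\<dots> \<le> (\<Sum>j\<in>UNIV. F $ i $ j * n j)"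
      by (intro sum_mono mult_left_mono F) (simp add: n_def)
    finally have "- h $ i \<le> (\<Sum>j\<in>UNIV. F $ i $ j * n j)" .
    moreover have "0 \<le> (\<Sum>j\<in>UNIV. F $ i $ j * n j)"
      by (intro sum_nonneg mult_nonneg_nonneg F n0)
    ultimately show ?thesis by (simp add: n_def)
  qed
  have "(\<Sum>i\<in>UNIV. n i) \<le> (\<Sum>i\<in>UNIV. \<Sum>j\<in>UNIV. F $ i $ j * n j)"
    by (intro sum_mono le)
  also have "\<dots> = (\<Sum>j\<in>UNIV. \<Sum>i\<in>UNIV. F $ i $ j * n j)"
    by (rule sum.swap)
  also have "\<dots> = q * (\<Sum>j\<in>UNIV. n j)"
    by (simp add: sum_distrib_right[symmetric] q sum_distrib_left[symmetric])
  finally have "(1 - q) * (\<Sum>i\<in>UNIV. n i) \<le> 0" by (simp add: algebra_simps)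
  then have "(\<Sum>i\<in>UNIV. n i) \<le> 0" using q(2) by (simp add: mult_le_0_iff)
  moreover have "n i \<le> (\<Sum>i\<in>UNIV. n i)" by (rule member_le_sum) (auto simp: n0)
  ultimately have "n i \<le> 0" by linarith
  then show ?thesis by (simp add: n_def)
qed

text \<open>The previous lemma applies to a kernel vector of I - F and to its negative, so the
  kernel is trivial; in finite dimension injectivity gives surjectivity.\<close>

lemma ex_solution_substochastic:
  fixes F :: "real^'n^'n"
  assumes F: "\<And>i j. 0 \<le> F $ i $ j" and q: "\<And>j. (\<Sum>i\<in>UNIV. F $ i $ j) = q" "q < 1"
  shows "\<exists>h. h - F *v h = b"
proof -
  have lin: "linear (\<lambda>h. h - F *v h)"
    by (intro linear_compose_sub linear_ident matrix_vector_mul_linear)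
  have "h = 0" if "h - F *v h = 0" for h
  proof -
    have e: "F *v h = h" using that by simp
    have e': "F *v (- h) = - h" using e by (metis diff_0 matrix_vector_mult_0_right matrix_vector_mult_diff_distrib)
    have "0 \<le> h $ i" for i using nonneg_of_ge_matrix_mult[OF F q, of h i] by (simp add: e)
    moreover have "0 \<le> (- h) $ i" for i
      using nonneg_of_ge_matrix_mult[OF F q, of "- h" i] by (simp only: e')
    ultimately show ?thesis by (simp add: vec_eq_iff order_antisym)
  qed
  then have "inj (\<lambda>h. h - F *v h)"
    using lin by (simp add: linear_injective_0)
  then have "surj (\<lambda>h. h - F *v h)"
    using lin by (simp add: linear_injective_imp_surjective)
  then show ?thesis by (metis surjD)
qed

lemma column_sum_matrix_vector_mult:
  fixes F :: "real^'n^'n"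
  assumes "\<And>j. (\<Sum>i\<in>UNIV. F $ i $ j) = q"
  shows "(\<Sum>i\<in>UNIV. (F *v h) $ i) = q * (\<Sum>i\<in>UNIV. h $ i)"
proof -
  have "(\<Sum>i\<in>UNIV. (F *v h) $ i) = (\<Sum>j\<in>UNIV. \<Sum>i\<in>UNIV. F $ i $ j * h $ j)"
    unfolding matrix_vector_mult_def by simp (rule sum.swap)
  then show ?thesis
    by (simp add: sum_distrib_right[symmetric] assms sum_distrib_left[symmetric])
qed

text \<open>With \<open>Q = (I - E\<^sup>2)\<^sup>-\<^sup>1\<close>, the solution is \<open>h = Q (u + E (1 - u))\<close>. The offset \<open>w = (I + E) Q E 1\<close>
  makes \<open>h\<close> nonnegative and does not depend on \<open>u\<close>.\<close>

lemma ex_nonneg_weights: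
  fixes E :: "real^'n^'n" and \<epsilon> :: real
  assumes E: "\<And>i j. 0 \<le> E $ i $ j" and col: "\<And>j. (\<Sum>i\<in>UNIV. E $ i $ j) = \<epsilon>" and "\<epsilon> < 1"
  shows "\<exists>w. \<forall>u. (\<forall>i. 0 \<le> u $ i \<and> u $ i \<le> 1) \<longrightarrow>
    (\<exists>h. (\<forall>i. 0 \<le> h $ i) \<and> h + E *v h = u + w \<and>
      (1 - \<epsilon>\<^sup>2) * (\<Sum>i\<in>UNIV. h $ i) =
        (\<Sum>i\<in>UNIV. u $ i) + \<epsilon> * (\<Sum>i\<in>UNIV. 1 - u $ i))"
proof -
  let ?F = "E ** E"
  have eps0: "0 \<le> \<epsilon>" using E col[of undefined] by (metis sum_nonneg)
  have q1: "\<epsilon>\<^sup>2 < 1" using eps0 \<open>\<epsilon> < 1\<close> by (simp add: power_less_one_iff abs_square_less_1)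
  have F: "0 \<le> ?F $ i $ j" for i j
    by (simp add: matrix_matrix_mult_def sum_nonneg E)
  have q: "(\<Sum>i\<in>UNIV. ?F $ i $ j) = \<epsilon>\<^sup>2" for j
  proof -
    have "(\<Sum>i\<in>UNIV. ?F $ i $ j) = (\<Sum>i\<in>UNIV. (E *v (\<chi> k. E $ k $ j)) $ i)"
      by (simp add: matrix_matrix_mult_def matrix_vector_mult_def)
    also have "\<dots> = \<epsilon>\<^sup>2"
      by (subst column_sum_matrix_vector_mult[OF col]) (simp add: col power2_eq_square)
    finally show ?thesis .
  qed
  obtain k where k: "k - ?F *v k = E *v 1" using ex_solution_substochastic[OF F q q1] by blast
  show ?thesis
  proof (rule exI[of _ "k + E *v k"], intro allI impI)
    fix u :: "real^'n" assume u: "\<forall>i. 0 \<le> u $ i \<and> u $ i \<le> 1"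
    obtain g where g: "g - ?F *v g = u" using ex_solution_substochastic[OF F q q1] by blast
    \<comment> \<open>Here \<open>k\<close> is Q E 1 and \<open>g\<close> is Q u. As Q commutes with
      E, this \<open>h\<close> is Q (u - E u + E 1), the solution announced above.\<close>
    define h where "h = g - E *v g + k"
    have h1: "h + E *v h = u + (k + E *v k)"
      using g by (simp add: h_def matrix_vector_mult_diff_distrib matrix_vector_right_distrib
          matrix_vector_mul_assoc algebra_simps)
    have comm: "?F *v (E *v g) = E *v (?F *v g)"
      by (simp add: matrix_vector_mul_assoc matrix_mul_assoc)
    have "h - ?F *v h = (g - ?F *v g) - (E *v g - E *v (?F *v g)) + (k - ?F *v k)"
      unfolding h_def matrix_vector_mult_diff_distrib matrix_vector_right_distrib comm
      by (simp add: algebra_simps)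
    also have "\<dots> = u - E *v (g - ?F *v g) + E *v 1"
      by (simp only: g k matrix_vector_mult_diff_distrib[symmetric])
    also have "\<dots> = u + E *v (1 - u)"
      by (simp add: g matrix_vector_mult_diff_distrib algebra_simps)
    finally have h2: "h - ?F *v h = u + E *v (1 - u)" .
    have "0 \<le> (u + E *v (1 - u)) $ i" for i
      using u by (auto simp: matrix_vector_mult_def intro!: add_nonneg_nonneg sum_nonneg mult_nonneg_nonneg E)
    then have "0 \<le> (h - ?F *v h) $ i" for i by (simp only: h2)
    then have h0: "0 \<le> h $ i" for i
      using nonneg_of_ge_matrix_mult[OF F q q1, of h i] by simp
    have "(1 - \<epsilon>\<^sup>2) * (\<Sum>i\<in>UNIV. h $ i) = (\<Sum>i\<in>UNIV. (h - ?F *v h) $ i)"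
      using column_sum_matrix_vector_mult[OF q, of h] by (simp add: sum_subtractf algebra_simps)
    also have "\<dots> = (\<Sum>i\<in>UNIV. u $ i) + \<epsilon> * (\<Sum>i\<in>UNIV. 1 - u $ i)"
      unfolding h2 using column_sum_matrix_vector_mult[OF col, of "1 - u"] by (simp add: sum.distrib)
    finally show "\<exists>h. (\<forall>i. 0 \<le> h $ i) \<and> h + E *v h = u + (k + E *v k) \<and>
      (1 - \<epsilon>\<^sup>2) * (\<Sum>i\<in>UNIV. h $ i) =
        (\<Sum>i\<in>UNIV. u $ i) + \<epsilon> * (\<Sum>i\<in>UNIV. 1 - u $ i)"
      using h0 h1 by blast
  qed
qed

section \<open>Norms given by four functionals with sum zero\<close>

text \<open>The values \<open>v i x\<close> identify the space with the hyperplane of sum zero in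
  four dimensions, where the unit ball is a central section of the cube [-1, 1]^4. Points can thus
  be chosen by prescribing four numbers.\<close>

locale octahedral_norm =
  fixes N :: "real^3 \<Rightarrow> real" and v :: "4 \<Rightarrow> real^3 \<Rightarrow> real"
  assumes norm: "is_norm N"
    and lin: "\<And>i. linear (v i)"
    and sum0: "\<And>x. (\<Sum>i\<in>UNIV. v i x) = 0"
    and unit: "\<And>x. N x \<le> 1 \<longleftrightarrow> (\<forall>i. \<bar>v i x\<bar> \<le> 1)"
    and onto: "\<And>y. (\<Sum>i\<in>UNIV. y i) = 0 \<Longrightarrow> \<exists>x. \<forall>i. v i x = y i"
    and compact_unit: "compact (unit_ball N)"
begin

lemma N_nonneg: "0 \<le> N x" and N_0_iff: "N x = 0 \<longleftrightarrow> x = 0"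
  and N_scale: "N (a *\<^sub>R x) = \<bar>a\<bar> * N x" and N_triangle: "N (x + y) \<le> N x + N y"
  using norm unfolding is_norm_def by auto

lemma N_minus: "N (- x) = N x"
  using N_scale[of "-1" x] by simp

lemma N_le_iff: assumes "0 < t" shows "N x \<le> t \<longleftrightarrow> (\<forall>i. \<bar>v i x\<bar> \<le> t)"
proof -
  have "N x \<le> t \<longleftrightarrow> N (inverse t *\<^sub>R x) \<le> 1"
    using assms by (simp add: N_scale field_simps)
  also have "\<dots> \<longleftrightarrow> (\<forall>i. \<bar>v i x\<bar> \<le> t)"
    using assms by (simp add: unit linear_scale[OF lin] abs_mult field_simps)
  finally show ?thesis .
qed

lemma N_leI: assumes "0 \<le> t" "\<And>i. \<bar>v i x\<bar> \<le> t" shows "N x \<le> t"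
\<comment> \<open>\<open>N_le_iff\<close> covers positive radii only; letting e tend to 0 includes t
  = 0.\<close>
proof (rule field_le_epsilon)
  fix e :: real assume "0 < e"
  then have "\<bar>v i x\<bar> \<le> t + e" for i using assms(2)[of i] by linarith
  then show "N x \<le> t + e" using assms(1) \<open>0 < e\<close> by (simp add: N_le_iff)
qed

lemma abs_v_le: "\<bar>v i x\<bar> \<le> N x"
proof (rule field_le_epsilon)
  fix e :: real assume "0 < e"
  then show "\<bar>v i x\<bar> \<le> N x + e"
    using N_le_iff[of "N x + e" x] N_nonneg[of x] by auto
qed

lemma v_inject: assumes "\<And>i. v i x = v i y" shows "x = y"
proof -
  have "N (x - y) \<le> 0" by (rule N_leI) (auto simp: linear_diff[OF lin] assms)
  then show ?thesis using N_nonneg[of "x - y"] N_0_iff[of "x - y"] by simp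
qed

lemma scaled_ball_eq: assumes "0 \<le> \<rho>" shows "scaled_ball N c \<rho> = {x. N (x - c) \<le> \<rho>}"
proof (cases "\<rho> = 0")
  case True
  have "0 \<in> unit_ball N" using N_0_iff[of 0] by (simp add: unit_ball_def)
  then have "scaled_ball N c \<rho> = {c}" using True by (auto simp: scaled_ball_def)
  moreover have "{x. N (x - c) \<le> \<rho>} = {c}"
    using True N_0_iff N_nonneg by (auto simp: order_antisym_conv)
  ultimately show ?thesis by simp
next
  case False
  then have pos: "0 < \<rho>" using assms by simp
  show ?thesis
  proof (intro equalityI subsetI)
    fix x assume "x \<in> scaled_ball N c \<rho>"
    then show "x \<in> {x. N (x - c) \<le> \<rho>}"
      using pos by (auto simp: scaled_ball_def unit_ball_def N_scale mult_left_le)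
  next
    fix x assume "x \<in> {x. N (x - c) \<le> \<rho>}"
    then have "inverse \<rho> *\<^sub>R (x - c) \<in> unit_ball N"
      using pos by (simp add: unit_ball_def N_scale divide_le_eq flip: divide_inverse_commute)
    moreover have "x = c + \<rho> *\<^sub>R (inverse \<rho> *\<^sub>R (x - c))" using pos by simp
    ultimately show "x \<in> scaled_ball N c \<rho>" unfolding scaled_ball_def by blast
  qed
qed

lemma scaled_ball_subsetD: "scaled_ball N c \<rho> \<subseteq> K \<Longrightarrow> N u \<le> 1 \<Longrightarrow> c + \<rho> *\<^sub>R u \<in> K"
  by (auto simp: scaled_ball_def unit_ball_def)

lemma ex_unit: "\<exists>u. N u = 1"
proof -
  have "(1 :: real^3) \<noteq> 0" by (simp add: vec_eq_iff)
  then obtain x :: "real^3" where "x \<noteq> 0" ..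
  then have "N x \<noteq> 0" by (simp add: N_0_iff)
  then have "N (inverse (N x) *\<^sub>R x) = 1" using N_nonneg[of x] by (simp add: N_scale)
  then show ?thesis ..
qed

lemma continuous_v: "continuous_on S (v i)"
  using lin by (rule linear_continuous_on_compose[OF continuous_on_id, simplified])

section \<open>A ball inscribed in the convex hull of four points\<close>

text \<open>The weights depend on the point \<open>x\<close> of the unit ball but the offset
  \<open>w\<close> does not, so one centre serves all \<open>x\<close>.\<close>

lemma ex_inscribed_ball:
  assumes K: "convex K" "\<And>j. p j \<in> K" and D_ge: "\<And>i j. v i (p i) - D \<le> v i (p j)"
    and \<rho>: "\<rho> = (\<Sum>i\<in>UNIV. v i (p i)) / 4 - D / 2" "0 < \<rho>"
  shows "\<exists>c. scaled_ball N c \<rho> \<subseteq> K"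
proof -
  define M where "M i = v i (p i)" for i
  \<comment> \<open>The diagonal is zero since \<open>M i\<close> is \<open>v i (p i)\<close>, and
    \<open>D_ge\<close> makes the other entries nonnegative.\<close>
  define E :: "real^4^4" where
    "E = (\<chi> i j. (v i (p j) - M i + D) / D - (if i = j then 1 else 0))"
  \<comment> \<open>Adding \<open>D_ge\<close> over \<open>i\<close> at one arbitrary
    \<open>p j\<close> bounds the sum of the \<open>v i (p i)\<close> by 4 D, so 0 < \<rho> \<le> D
    / 2.\<close>
  have "(\<Sum>i\<in>UNIV. v i (p i) - D) \<le> (\<Sum>i\<in>UNIV. v i (p undefined))"
    by (intro sum_mono D_ge)
  then have "(\<Sum>i\<in>UNIV. v i (p i)) \<le> 4 * D" by (simp add: sum_subtractf sum0)
  then have D: "0 < D" using \<rho> by simp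
  define \<epsilon> where "\<epsilon> = 1 - 4 * \<rho> / D"
  have E0: "0 \<le> E $ i $ j" for i j
    using D D_ge[of i j] by (auto simp: E_def M_def field_simps)
  have col: "(\<Sum>i\<in>UNIV. E $ i $ j) = \<epsilon>" for j
  proof -
    have "(\<Sum>i\<in>UNIV. E $ i $ j) = (\<Sum>i\<in>UNIV. v i (p j) - M i + D) / D - 1"
      by (simp add: E_def sum_subtractf sum_divide_distrib)
    also have "\<dots> = (4 * D - (\<Sum>i\<in>UNIV. M i)) / D - 1"
      by (simp add: sum.distrib sum_subtractf sum0)
    also have "\<dots> = \<epsilon>" using D by (simp add: \<epsilon>_def \<rho> M_def field_simps)
    finally show ?thesis .
  qed
  have eps1: "\<epsilon> < 1" using \<rho>(2) D by (simp add: \<epsilon>_def)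
  have eps0: "0 \<le> \<epsilon>" using E0 col[of undefined] by (metis sum_nonneg)
  obtain w where w: "\<And>u. (\<forall>i. 0 \<le> u $ i \<and> u $ i \<le> 1) \<Longrightarrow>
    \<exists>h. (\<forall>i. 0 \<le> h $ i) \<and> h + E *v h = u + w \<and>
      (1 - \<epsilon>\<^sup>2) * (\<Sum>i\<in>UNIV. h $ i) =
        (\<Sum>i\<in>UNIV. u $ i) + \<epsilon> * (\<Sum>i\<in>UNIV. 1 - u $ i)"
    using ex_nonneg_weights[OF E0 col eps1] by blast
  have *: "\<exists>z\<in>K. \<forall>i. v i z = \<rho> * v i x + (\<rho> + 2 * \<rho> * w $ i + M i - D)" if "N x \<le> 1" for x
  proof -
    \<comment> \<open>\<open>u\<close> rescales the values to [0, 1]. Its entries and those of 1 - u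
      both sum to 2, so the weights \<open>h\<close> sum to 2 / (1 - \<epsilon>) = D / (2 \<rho>),
      which dictates the factor in \<open>a\<close>.\<close>
    define u :: "real^4" where "u = (\<chi> i. (1 + v i x) / 2)"
    have "\<bar>v i x\<bar> \<le> 1" for i using that unit by blast
    then have u01: "\<forall>i. 0 \<le> u $ i \<and> u $ i \<le> 1" by (simp add: u_def abs_le_iff) (smt (verit))
    have su: "(\<Sum>i\<in>UNIV. u $ i) = 2"
      by (simp add: u_def sum_divide_distrib[symmetric] sum.distrib sum0)
    obtain h where h: "\<And>i. 0 \<le> h $ i" "h + E *v h = u + w"
      "(1 - \<epsilon>\<^sup>2) * (\<Sum>i\<in>UNIV. h $ i) = (\<Sum>i\<in>UNIV. u $ i) + \<epsilon> * (\<Sum>i\<in>UNIV. 1 - u $ i)"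
      using w[OF u01] by blast
    have "(1 + \<epsilon>) * ((1 - \<epsilon>) * (\<Sum>i\<in>UNIV. h $ i)) = (1 + \<epsilon>) * 2"
      using h(3) by (simp add: su sum_subtractf power2_eq_square algebra_simps)
    then have sh: "(1 - \<epsilon>) * (\<Sum>i\<in>UNIV. h $ i) = 2" using eps0 by (simp only: mult_cancel_left) simp
    define a where "a j = 2 * \<rho> / D * h $ j" for j
    have a0: "0 \<le> a j" for j using \<rho>(2) D h(1) by (simp add: a_def)
    have sa: "(\<Sum>j\<in>UNIV. a j) = 1"
      using sh D unfolding a_def \<epsilon>_def by (subst sum_distrib_left[symmetric]) (simp add: field_simps)
    define z where "z = (\<Sum>j\<in>UNIV. a j *\<^sub>R p j)"
    have "z \<in> K" unfolding z_def by (rule convex_sum) (use K sa a0 in auto)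
    moreover have "v i z = \<rho> * v i x + (\<rho> + 2 * \<rho> * w $ i + M i - D)" for i
    proof -
      have vp: "v i (p j) = D * (E $ i $ j + (if i = j then 1 else 0)) + M i - D" for j
        using D by (simp add: E_def field_simps)
      have "v i z = (\<Sum>j\<in>UNIV. a j * v i (p j))"
        unfolding z_def by (simp add: linear_sum[OF lin] linear_scale[OF lin])
      also have "\<dots> = (\<Sum>j\<in>UNIV. 2 * \<rho> * (E $ i $ j * h $ j) + (if i = j then 2 * \<rho> * h $ j else 0)
          + (M i - D) * a j)"
        using D by (intro sum.cong) (auto simp: vp a_def field_simps)
      also have "\<dots> = 2 * \<rho> * (\<Sum>j\<in>UNIV. E $ i $ j * h $ j) + 2 * \<rho> * h $ i + (M i - D)"
        by (simp add: sum.distrib sum_distrib_left[symmetric] sa)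
      also have "\<dots> = 2 * \<rho> * (h + E *v h) $ i + (M i - D)"
        by (simp add: matrix_vector_mult_def algebra_simps)
      also have "\<dots> = \<rho> * v i x + (\<rho> + 2 * \<rho> * w $ i + M i - D)"
        unfolding h(2) by (simp add: u_def field_simps)
      finally show ?thesis .
    qed
    ultimately show ?thesis by blast
  qed
  \<comment> \<open>The centre is the point obtained for x = 0, whose values are the offset.\<close>
  obtain c where c: "\<And>i. v i c = \<rho> + 2 * \<rho> * w $ i + M i - D"
    using *[of 0] N_0_iff[of 0] by (auto simp: linear_0[OF lin])
  have "c + \<rho> *\<^sub>R x \<in> K" if x: "N x \<le> 1" for x
  proof -
    obtain z where z: "z \<in> K" "\<And>i. v i z = \<rho> * v i x + (\<rho> + 2 * \<rho> * w $ i + M i - D)"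
      using *[OF x] by blast
    have "c + \<rho> *\<^sub>R x = z"
      by (rule v_inject) (simp add: linear_add[OF lin] linear_scale[OF lin] c z(2))
    then show ?thesis using z(1) by simp
  qed
  then show ?thesis by (auto simp: scaled_ball_def unit_ball_def)
qed


section \<open>Inradius, diameter and circumradius of a convex body\<close>

context
  fixes K :: "(real^3) set" assumes K: "convex_body K"
begin

text \<open>Makes the set of circumscribed radii nonempty and the set of distances bounded, so that
  \<open>Inf\<close> and \<open>Sup\<close> have their usual meaning.\<close>

lemma ex_N_bound: "\<exists>C\<ge>0. \<forall>x\<in>K. N x \<le> C"
proof -
  have "bounded (v i ` K)" for i
    using K by (intro compact_imp_bounded compact_continuous_image continuous_v) (simp add: convex_body_def)
  then have "\<forall>i. \<exists>C. \<forall>x\<in>K. \<bar>v i x\<bar> \<le> C" by (auto simp: bounded_real)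
  then obtain C where C: "\<And>i x. x \<in> K \<Longrightarrow> \<bar>v i x\<bar> \<le> C i" by metis
  obtain x where "x \<in> K" using K by (auto simp: convex_body_def)
  then have C0: "0 \<le> C i" for i using C[of x i] by linarith
  have "C i \<le> (\<Sum>i\<in>UNIV. C i)" for i by (rule member_le_sum) (auto simp: C0)
  then have "\<forall>x\<in>K. N x \<le> (\<Sum>i\<in>UNIV. C i)"
    using C by (auto intro!: N_leI sum_nonneg C0 intro: order_trans)
  then show ?thesis using C0 by (meson sum_nonneg)
qed

lemma norm_le_diameter: assumes "x \<in> K" "y \<in> K" shows "N (x - y) \<le> norm_diameter N K"
proof -
  obtain C where C: "\<And>x. x \<in> K \<Longrightarrow> N x \<le> C" using ex_N_bound by blast
  have "N (x - y) \<le> C + C" if "x \<in> K" "y \<in> K" for x y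
    using N_triangle[of x "- y"] C[OF that(1)] C[OF that(2)] by (simp add: N_minus)
  then have "bdd_above {N (x - y) | x y. x \<in> K \<and> y \<in> K}" by (fastforce intro: bdd_aboveI)
  then show ?thesis unfolding norm_diameter_def using assms by (intro cSup_upper) auto
qed

lemma diameter_le:
  assumes "\<And>x y. x \<in> K \<Longrightarrow> y \<in> K \<Longrightarrow> N (x - y) \<le> t" shows "norm_diameter N K \<le> t"
  unfolding norm_diameter_def using assms K by (intro cSup_least) (fastforce simp: convex_body_def)+

lemma circumradius_le:
  assumes "0 \<le> \<rho>" "\<And>x. x \<in> K \<Longrightarrow> N (x - c) \<le> \<rho>" shows "circumradius N K \<le> \<rho>"
  unfolding circumradius_def
proof (rule cInf_lower)
  show "\<rho> \<in> {\<rho>. \<rho> \<ge> 0 \<and> (\<exists>c. K \<subseteq> scaled_ball N c \<rho>)}"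
    using assms by (auto simp: scaled_ball_eq)
qed (auto intro: bdd_belowI[of _ 0])

lemma circumradius_ge:
  assumes "\<And>\<rho> c. 0 \<le> \<rho> \<Longrightarrow> (\<And>x. x \<in> K \<Longrightarrow> N (x - c) \<le> \<rho>) \<Longrightarrow> t \<le> \<rho>"
  shows "t \<le> circumradius N K"
  unfolding circumradius_def
proof (rule cInf_greatest)
  obtain C where "0 \<le> C" "\<And>x. x \<in> K \<Longrightarrow> N x \<le> C" using ex_N_bound by blast
  then have "K \<subseteq> scaled_ball N 0 C" by (auto simp: scaled_ball_eq)
  then show "{\<rho>. \<rho> \<ge> 0 \<and> (\<exists>c. K \<subseteq> scaled_ball N c \<rho>)} \<noteq> {}" using \<open>0 \<le> C\<close> by blast
next
  fix \<rho> assume "\<rho> \<in> {\<rho>. \<rho> \<ge> 0 \<and> (\<exists>c. K \<subseteq> scaled_ball N c \<rho>)}"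
  then obtain c where "0 \<le> \<rho>" "K \<subseteq> {x. N (x - c) \<le> \<rho>}" by (auto simp: scaled_ball_eq)
  then show "t \<le> \<rho>" using assms[of \<rho> c] by blast
qed

text \<open>Two opposite boundary points of the ball lie at distance 2 \<rho>. The bound also keeps
  the supremum defining the inradius finite.\<close>

lemma ball_radius_le_diameter:
  assumes "0 \<le> \<rho>" "scaled_ball N c \<rho> \<subseteq> K" shows "2 * \<rho> \<le> norm_diameter N K"
proof -
  obtain u where u: "N u = 1" using ex_unit by blast
  then have "c + \<rho> *\<^sub>R u \<in> K" "c + \<rho> *\<^sub>R (- u) \<in> K"
    using scaled_ball_subsetD[OF assms(2)] by (simp_all add: N_minus del: scaleR_minus_right)
  then have "N ((c + \<rho> *\<^sub>R u) - (c + \<rho> *\<^sub>R (- u))) \<le> norm_diameter N K"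
    by (rule norm_le_diameter)
  also have "(c + \<rho> *\<^sub>R u) - (c + \<rho> *\<^sub>R (- u)) = (2 * \<rho>) *\<^sub>R u"
    by (simp add: scaleR_2 flip: scaleR_scaleR)
  finally show ?thesis using u assms(1) by (simp add: N_scale)
qed

lemma inradius_ge:
  assumes "0 \<le> \<rho>" "scaled_ball N c \<rho> \<subseteq> K" shows "\<rho> \<le> inradius N K"
  unfolding inradius_def
proof (rule cSup_upper)
  show "bdd_above {\<rho>. \<rho> \<ge> 0 \<and> (\<exists>c. scaled_ball N c \<rho> \<subseteq> K)}"
    using ball_radius_le_diameter by (intro bdd_aboveI[of _ "norm_diameter N K"]) force
qed (use assms in auto)

lemma ex_degenerate_ball: "\<exists>c. scaled_ball N c 0 \<subseteq> K"
  using K by (auto simp: scaled_ball_def convex_body_def)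

lemma inradius_le:
  assumes "\<And>\<rho> c. 0 \<le> \<rho> \<Longrightarrow> scaled_ball N c \<rho> \<subseteq> K \<Longrightarrow> \<rho> \<le> t"
  shows "inradius N K \<le> t"
  unfolding inradius_def
  by (rule cSup_least) (use assms ex_degenerate_ball in auto)

lemma inradius_nonneg: "0 \<le> inradius N K"
  using ex_degenerate_ball inradius_ge[of 0] by auto

lemma diameter_le_circumradius: "norm_diameter N K \<le> 2 * circumradius N K"
proof -
  have "norm_diameter N K / 2 \<le> circumradius N K"
  proof (rule circumradius_ge)
    fix \<rho> c assume *: "\<And>x. x \<in> K \<Longrightarrow> N (x - c) \<le> \<rho>"
    have "norm_diameter N K \<le> 2 * \<rho>"
    proof (rule diameter_le)
      fix x y assume "x \<in> K" "y \<in> K"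
      then show "N (x - y) \<le> 2 * \<rho>"
        using *[of x] *[of y] N_triangle[of "x - c" "- (y - c)"] N_minus[of "y - c"] by simp
    qed
    then show "norm_diameter N K / 2 \<le> \<rho>" by simp
  qed
  then show ?thesis by simp
qed

text \<open>For an inscribed ball with centre c and a point x of K, the boundary point z of the ball
  opposite to x satisfies N (x - z) = N (x - c) + \<rho>. Hence K lies in the ball about c of radius
  D - \<rho>, and \<rho> passes to the supremum.\<close>

lemma inradius_circumradius_le: "inradius N K + circumradius N K \<le> norm_diameter N K"
proof -
  have "inradius N K \<le> norm_diameter N K - circumradius N K"
  proof (rule inradius_le)
    fix \<rho> c assume \<rho>: "0 \<le> \<rho>" "scaled_ball N c \<rho> \<subseteq> K"
    have "circumradius N K \<le> norm_diameter N K - \<rho>"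
    proof (rule circumradius_le)
      show "0 \<le> norm_diameter N K - \<rho>" using ball_radius_le_diameter[OF \<rho>] \<rho>(1) by simp
      fix x assume x: "x \<in> K"
      show "N (x - c) \<le> norm_diameter N K - \<rho>"
      proof (cases "x = c")
        case True
        then show ?thesis using ball_radius_le_diameter[OF \<rho>] \<rho>(1) N_0_iff[of 0] by simp
      next
        case False
        define t where "t = N (x - c)"
        have t: "0 < t" using False N_nonneg[of "x - c"] N_0_iff[of "x - c"] by (simp add: t_def)
        define z where "z = c + \<rho> *\<^sub>R (- inverse t *\<^sub>R (x - c))"
        have "N (- inverse t *\<^sub>R (x - c)) \<le> 1"
          unfolding N_scale t_def[symmetric] using t by simp
        then have "z \<in> K" unfolding z_def by (rule scaled_ball_subsetD[OF \<rho>(2)])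
        then have "N (x - z) \<le> norm_diameter N K" using x norm_le_diameter by blast
        moreover have "x - z = (1 + \<rho> * inverse t) *\<^sub>R (x - c)"
          by (simp add: z_def algebra_simps)
        then have "N (x - z) = (1 + \<rho> * inverse t) * t"
          using t \<rho>(1) by (simp add: N_scale t_def[symmetric])
        moreover have "(1 + \<rho> * inverse t) * t = t + \<rho>" using t by (simp add: algebra_simps)
        ultimately show ?thesis by (simp add: t_def)
      qed
    qed
    then show "\<rho> \<le> norm_diameter N K - circumradius N K" by simp
  qed
  then show ?thesis by simp
qed

lemma ex_maximizer: "\<exists>p\<in>K. \<forall>x\<in>K. v i x \<le> v i p"
  using K continuous_v[of K i] by (auto simp: convex_body_def intro!: continuous_attains_sup)

text \<open>\<open>ex_inscribed_ball\<close> applies because \<open>v i\<close> changes by at most N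
  (p i - p j) \<le> D between two of the points; a nonpositive radius is covered by
  \<open>inradius_nonneg\<close>.\<close>

lemma inradius_ge_maximizers:
  assumes "\<And>i. p i \<in> K"
  shows "(\<Sum>i\<in>UNIV. v i (p i)) / 4 - norm_diameter N K / 2 \<le> inradius N K"
    (is "?\<rho> \<le> _")
proof (cases "0 < ?\<rho>")
  case True
  have "v i (p i) - norm_diameter N K \<le> v i (p j)" for i j
    using norm_le_diameter[OF assms[of i] assms[of j]] abs_v_le[of i "p i - p j"]
    by (simp add: linear_diff[OF lin])
  then have "\<exists>c. scaled_ball N c ?\<rho> \<subseteq> K"
    using K assms True by (intro ex_inscribed_ball) (auto simp: convex_body_def)
  then show ?thesis using True inradius_ge[of ?\<rho>] by auto
next
  case False
  then show ?thesis using inradius_nonneg by linarith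
qed

end

section \<open>Circumradius minus inradius\<close>

text \<open>By the symmetry of the ball, negated functionals describe the same norm, so every result
  on maxima of \<open>v i\<close> also yields one on minima.\<close>

lemma octahedral_norm_uminus: "octahedral_norm N (\<lambda>i x. - v i x)"
proof (rule octahedral_norm.intro)
  show "\<exists>x. \<forall>i. - v i x = y i" if y: "(\<Sum>i\<in>UNIV. y i) = 0" for y
  proof -
    obtain x where "\<forall>i. v i x = y i" using onto[OF y] by blast
    then have "\<forall>i. - v i (- x) = y i" by (simp add: linear_neg[OF lin])
    then show ?thesis ..
  qed
  show "linear (\<lambda>x. - v i x)" for i
    by (intro linear_compose_neg lin)
qed (simp_all add: norm sum_negf sum0 unit compact_unit)

lemma circumradius_minus_inradius_le:
  assumes K: "convex_body K"
  shows "2 * (circumradius N K - inradius N K) \<le> norm_diameter N K"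
proof -
  interpret neg: octahedral_norm N "\<lambda>i x. - v i x" by (rule octahedral_norm_uminus)
  let ?D = "norm_diameter N K"
  obtain p where p: "\<And>i. p i \<in> K" "\<And>i x. x \<in> K \<Longrightarrow> v i x \<le> v i (p i)"
    using ex_maximizer[OF K] by metis
  obtain q where q: "\<And>i. q i \<in> K" "\<And>i x. x \<in> K \<Longrightarrow> v i (q i) \<le> v i x"
    using neg.ex_maximizer[OF K] by (metis neg_le_iff_le)
  let ?P = "(\<Sum>i\<in>UNIV. v i (p i)) / 4" and ?Q = "(\<Sum>i\<in>UNIV. - v i (q i)) / 4"
  \<comment> \<open>A ball of radius \<rho> about \<open>c\<close> contains \<open>K\<close> as soon
    as v i (p i) - \<rho> \<le> v i c \<le> v i (q i) + \<rho>. The term D / 2 makes these intervals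
    nonempty; \<open>?P\<close> and \<open>?Q\<close> make the lower ends sum to at most 0 and the
    upper ends to at least 0.\<close>
  define \<rho> where "\<rho> = max (?D / 2) (max ?P ?Q)"
  have width: "v i (p i) - v i (q i) \<le> ?D" for i
    using norm_le_diameter[OF K p(1)[of i] q(1)[of i]] abs_v_le[of i "p i - q i"]
    by (simp add: linear_diff[OF lin])
  have "N (p 0 - p 0) \<le> ?D" using norm_le_diameter[OF K p(1) p(1)] .
  then have \<rho>0: "0 \<le> \<rho>" using N_nonneg[of "p 0 - p 0"] by (simp add: \<rho>_def)
  have "circumradius N K \<le> \<rho>"
  proof -
    define l where "l i = v i (p i) - \<rho>" for i
    define u where "u i = v i (q i) + \<rho>" for i
    have lu: "l i \<le> u i" for i using width[of i] by (simp add: l_def u_def \<rho>_def)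
    have sl: "(\<Sum>i\<in>UNIV. l i) \<le> 0"
      by (simp add: l_def sum_subtractf \<rho>_def)
    have su: "0 \<le> (\<Sum>i\<in>UNIV. u i)"
    proof -
      have "?Q \<le> \<rho>" by (simp add: \<rho>_def)
      then show ?thesis by (simp add: u_def sum.distrib sum_negf)
    qed
    \<comment> \<open>Moving from all lower ends to all upper ends, the sum passes through zero;
      \<open>onto\<close> turns the values found there into a centre.\<close>
    have "\<exists>t. 0 \<le> t \<and> t \<le> 1 \<and> (\<Sum>i\<in>UNIV. l i + t * (u i - l i)) = 0"
    proof -
      let ?f = "\<lambda>t. \<Sum>i\<in>UNIV. l i + t * (u i - l i)"
      have "\<exists>t\<ge>0. t \<le> 1 \<and> ?f t = 0"
        by (rule IVT') (use sl su in \<open>auto intro!: continuous_intros\<close>)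
      then show ?thesis by blast
    qed
    then obtain t where t: "0 \<le> t" "t \<le> 1" "(\<Sum>i\<in>UNIV. l i + t * (u i - l i)) = 0" by blast
    then obtain c where c: "\<And>i. v i c = l i + t * (u i - l i)" using onto by blast
    have lc: "l i \<le> v i c" "v i c \<le> u i" for i
      using t(1,2) lu[of i] mult_right_le_one_le[of "u i - l i" t] by (auto simp: c mult.commute)
    show ?thesis
    proof (rule circumradius_le[OF K \<rho>0])
      fix x assume "x \<in> K"
      then show "N (x - c) \<le> \<rho>"
        using lc p(2) q(2) \<rho>0
        by (intro N_leI) (auto simp: linear_diff[OF lin] abs_le_iff l_def u_def, (smt (verit))+)
    qed
  qed
  \<comment> \<open>One case for each term of the maximum: D / 2 uses that the inradius is
    nonnegative, \<open>?P\<close> and \<open>?Q\<close> use the balls inscribed via the maximisers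
    and the minimisers.\<close>
  moreover have "\<rho> - ?D / 2 \<le> inradius N K"
    using inradius_nonneg[OF K] inradius_ge_maximizers[OF K, of p] p(1)
      neg.inradius_ge_maximizers[OF K, of q] q(1)
    by (simp add: \<rho>_def max_def)
  ultimately show ?thesis by simp
qed

section \<open>Bodies realising every admissible triple\<close>

lemma ex_body:
  assumes "D \<le> 2 * R" "r + R \<le> D" "2 * (R - r) \<le> D"
  shows "\<exists>K. convex_body K \<and> inradius N K = r \<and> norm_diameter N K = D \<and> circumradius N K = R"
proof -
  \<comment> \<open>the coordinates of \<open>(r, D, R)\<close> with respect to \<open>(1, 4, 3)\<close>, \<open>(1, 2, 1)\<close>, \<open>(0, 2, 1)\<close>\<close>
  define a where "a = R - D / 2"
  define b where "b = r - a"
  define c where "c = D - R - r"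
  \<comment> \<open>Each sign condition is one of the three assumptions, so the admissible triples
    form the cone spanned by the three model triples.\<close>
  have abc: "0 \<le> a" "0 \<le> b" "0 \<le> c" using assms by (auto simp: a_def b_def c_def)
  have r: "r = a + b" and D: "D = 4 * a + 2 * b + 2 * c" and R: "R = 3 * a + b + c"
    by (auto simp: a_def b_def c_def)
  have s4: "v 1 x + v 2 x + v 3 x + v 4 x = 0" for x using sum0[of x] by (simp add: sum_4)
  define T where "T = {x. \<forall>i. -1 \<le> v i x}"
  \<comment> \<open>The other three values are at least -1 and all four sum to zero.\<close>
  have T3: "v i x \<le> 3" if "x \<in> T" for i x
    using that s4[of x] exhaust_4[of i] by (auto simp: T_def forall_4)
  have N_T: "N x \<le> 3" if "x \<in> T" for x
    using that T3[OF that] by (intro N_leI) (auto simp: T_def abs_le_iff minus_le_iff intro: order_trans[rotated])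
  have closed_T: "closed T"
  proof -
    have "T = (\<Inter>i. {x. -1 \<le> v i x})" by (auto simp: T_def)
    also have "closed \<dots>"
      by (intro closed_INT ballI closed_Collect_le continuous_v continuous_intros)
    finally show ?thesis .
  qed
  have "T \<subseteq> (\<lambda>x. 3 *\<^sub>R x) ` unit_ball N"
  proof
    fix x assume "x \<in> T"
    then have "inverse 3 *\<^sub>R x \<in> unit_ball N" using N_T by (simp add: unit_ball_def N_scale)
    moreover have "x = 3 *\<^sub>R (inverse 3 *\<^sub>R x)" by simp
    ultimately show "x \<in> (\<lambda>x. 3 *\<^sub>R x) ` unit_ball N" by blast
  qed
  then have compact_T: "compact T"
    using closed_T compact_scaling[OF compact_unit, of 3]
    by (metis compact_Int_closed inf.absorb_iff2)
  have convex_T: "convex T"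
  proof (rule convexI)
    fix x y and s t :: real assume *: "x \<in> T" "y \<in> T" "0 \<le> s" "0 \<le> t" "s + t = 1"
    have "-1 \<le> s * v i x + t * v i y" for i
    proof -
      have "s * (-1) + t * (-1) \<le> s * v i x + t * v i y"
        using * by (intro add_mono mult_left_mono) (auto simp: T_def)
      then show ?thesis using *(5) by (simp add: algebra_simps)
    qed
    then show "s *\<^sub>R x + t *\<^sub>R y \<in> T"
      by (simp add: T_def linear_add[OF lin] linear_scale[OF lin])
  qed
  have convex_B: "convex (unit_ball N)"
  proof (rule convexI)
    fix x y and s t :: real
    assume *: "x \<in> unit_ball N" "y \<in> unit_ball N" "0 \<le> s" "0 \<le> t" "s + t = 1"
    have "N (s *\<^sub>R x + t *\<^sub>R y) \<le> s * N x + t * N y"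
      using N_triangle[of "s *\<^sub>R x" "t *\<^sub>R y"] * by (simp add: N_scale)
    also have "\<dots> \<le> s * 1 + t * 1"
      using * by (intro add_mono mult_left_mono) (auto simp: unit_ball_def)
    finally show "s *\<^sub>R x + t *\<^sub>R y \<in> unit_ball N" using * by (simp add: unit_ball_def)
  qed
  \<comment> \<open>\<open>y j\<close> lists the values at the vertex of \<open>T\<close> where all
    facet inequalities but the \<open>j\<close>-th are tight.\<close>
  define y :: "4 \<Rightarrow> 4 \<Rightarrow> real" where "y j i = (if i = j then 3 else -1)" for j i
  have "\<exists>x. \<forall>i. v i x = y j i" for j
    by (rule onto) (use exhaust_4[of j] in \<open>auto simp: y_def sum_4\<close>)
  then obtain e where e: "\<And>j i. v i (e j) = y j i" by metis
  have eT: "e j \<in> T" for j by (simp add: T_def e y_def)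
  \<comment> \<open>The vertices of the unit ball have two values 1 and two values -1.
    \<open>s\<close> spans the segment; \<open>m\<close> tests the inradius, since v 1 + v 3 is 0 at
    \<open>s\<close> and 2 at \<open>m\<close>.\<close>
  have "\<exists>x. \<forall>i. v i x = (if i = 1 \<or> i = 2 then 1 else -1)"
    by (rule onto) (simp add: sum_4)
  then obtain s where s: "\<And>i. v i s = (if i = 1 \<or> i = 2 then 1 else -1)" by blast
  have "\<exists>x. \<forall>i. v i x = (if i = 1 \<or> i = 3 then 1 else -1)"
    by (rule onto) (simp add: sum_4)
  then obtain m where m: "\<And>i. v i m = (if i = 1 \<or> i = 3 then 1 else -1)" by blast
  have N1: "N s \<le> 1" "N m \<le> 1" by (auto simp: unit s m)
  \<comment> \<open>As a linear image of a product, \<open>K\<close> inherits convexity and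
    compactness from its factors.\<close>
  define g where "g = (\<lambda>(x, z, \<tau>). a *\<^sub>R x + b *\<^sub>R z + (c * \<tau>) *\<^sub>R s)"
  define K where "K = g ` (T \<times> unit_ball N \<times> {-1..1})"
  have lin_g: "linear g"
    by (rule linearI) (auto simp: g_def algebra_simps)
  have body: "convex_body K"
  proof -
    have "K \<noteq> {}" using eT N1 by (auto simp: K_def unit_ball_def)
    moreover have "convex K" unfolding K_def
      by (intro convex_linear_image lin_g convex_Times convex_T convex_B convex_real_interval)
    moreover have "compact K" unfolding K_def
      by (intro compact_continuous_image compact_Times compact_T compact_unit compact_Icc
          linear_continuous_on linear_conv_bounded_linear[THEN iffD1] lin_g)
    ultimately show ?thesis by (simp add: convex_body_def)
  qed
  have memK: "a *\<^sub>R x + b *\<^sub>R z + (c * \<tau>) *\<^sub>R s \<in> K"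
    if "x \<in> T" "N z \<le> 1" "-1 \<le> \<tau>" "\<tau> \<le> 1" for x z \<tau>
    using that unfolding K_def g_def by (force simp: unit_ball_def)
  have K_elim: "\<exists>x z \<tau>. k = a *\<^sub>R x + b *\<^sub>R z + (c * \<tau>) *\<^sub>R s \<and> x \<in> T \<and> N z \<le> 1 \<and> \<bar>\<tau>\<bar> \<le> 1"
    if "k \<in> K" for k using that unfolding K_def g_def by (force simp: unit_ball_def abs_le_iff)
  have N_sum3: "N (a *\<^sub>R x + b *\<^sub>R z + (c * \<tau>) *\<^sub>R s) \<le> a * N x + b * N z + c * \<bar>\<tau>\<bar>" for x z \<tau>
  proof -
    have "N (a *\<^sub>R x + b *\<^sub>R z + (c * \<tau>) *\<^sub>R s) \<le> a * N x + b * N z + c * \<bar>\<tau>\<bar> * N s"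
      using N_triangle[of "a *\<^sub>R x + b *\<^sub>R z" "(c * \<tau>) *\<^sub>R s"] N_triangle[of "a *\<^sub>R x" "b *\<^sub>R z"] abc
      by (simp add: N_scale abs_mult)
    moreover have "c * \<bar>\<tau>\<bar> * N s \<le> c * \<bar>\<tau>\<bar>" using abc N1 by (simp add: mult_left_le)
    ultimately show ?thesis by linarith
  qed
  have v_sum3: "v i (a *\<^sub>R x + b *\<^sub>R z + t *\<^sub>R s) = a * v i x + b * v i z + t * v i s" for i x z t
    by (simp add: linear_add[OF lin] linear_scale[OF lin])
  have circ: "circumradius N K = R"
  proof (rule antisym)
    show "circumradius N K \<le> R"
    proof (rule circumradius_le[OF body, of _ 0])
      show "0 \<le> R" using abc by (simp add: R)
      fix k assume "k \<in> K"
      then obtain x z \<tau> where k: "k = a *\<^sub>R x + b *\<^sub>R z + (c * \<tau>) *\<^sub>R s" "x \<in> T" "N z \<le> 1" "\<bar>\<tau>\<bar> \<le> 1"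
        using K_elim by blast
      have "N k \<le> a * N x + b * N z + c * \<bar>\<tau>\<bar>" unfolding k(1) by (rule N_sum3)
      also have "\<dots> \<le> a * 3 + b * 1 + c * 1"
        using k N_T abc by (intro add_mono mult_left_mono) auto
      finally show "N (k - 0) \<le> R" by (simp add: R)
    qed
    show "R \<le> circumradius N K"
    proof (rule circumradius_ge[OF body])
      fix \<rho> z assume \<rho>: "\<And>x. x \<in> K \<Longrightarrow> N (x - z) \<le> \<rho>"
      \<comment> \<open>The functional \<open>v i\<close> takes the value R at the point
        \<open>?k\<close> of \<open>K\<close>; the sign \<open>t\<close> ensures v i (t s) = 1.
        Adding the four bounds eliminates the centre \<open>z\<close>, whose values sum to
        zero.\<close>
      have "R - v i z \<le> \<rho>" for i
      proof -
        define t :: real where "t = v i s"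
        have t: "-1 \<le> t" "t \<le> 1" "t * t = 1" by (auto simp: t_def s)
        let ?k = "a *\<^sub>R e i + b *\<^sub>R (t *\<^sub>R s) + (c * t) *\<^sub>R s"
        have "N (t *\<^sub>R s) \<le> 1" using t N1 by (auto simp: N_scale abs_le_iff mult_le_one N_nonneg)
        then have "?k \<in> K" using t by (intro memK eT) auto
        then have "v i (?k - z) \<le> \<rho>" using \<rho>[of ?k] abs_v_le[of i "?k - z"] by linarith
        moreover have "v i ?k = R"
          using t(3) unfolding v_sum3 by (simp add: linear_scale[OF lin] e y_def R t_def[symmetric] mult.assoc)
        ultimately show ?thesis by (simp add: linear_diff[OF lin])
      qed
      then have "(\<Sum>i\<in>UNIV. R - v i z) \<le> (\<Sum>i\<in>(UNIV::4 set). \<rho>)" by (intro sum_mono)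
      then show "R \<le> \<rho>" by (simp add: sum_subtractf sum0)
    qed
  qed
  have diam: "norm_diameter N K = D"
  proof (rule antisym)
    show "norm_diameter N K \<le> D"
    proof (rule diameter_le[OF body])
      fix k k' assume "k \<in> K" "k' \<in> K"
      then obtain x z \<tau> x' z' \<tau>' where
        k: "k = a *\<^sub>R x + b *\<^sub>R z + (c * \<tau>) *\<^sub>R s" "x \<in> T" "N z \<le> 1" "\<bar>\<tau>\<bar> \<le> 1" and
        k': "k' = a *\<^sub>R x' + b *\<^sub>R z' + (c * \<tau>') *\<^sub>R s" "x' \<in> T" "N z' \<le> 1" "\<bar>\<tau>'\<bar> \<le> 1"
        using K_elim by metis
      have "\<bar>v i (x - x')\<bar> \<le> 4" for i
        using T3[OF k(2), of i] T3[OF k'(2), of i] k(2) k'(2)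
        by (simp add: T_def linear_diff[OF lin] abs_le_iff) (smt (verit))
      then have x: "N (x - x') \<le> 4" by (intro N_leI) auto
      have z: "N (z - z') \<le> 2" using N_triangle[of z "- z'"] k k' by (simp add: N_minus)
      have "k - k' = a *\<^sub>R (x - x') + b *\<^sub>R (z - z') + (c * (\<tau> - \<tau>')) *\<^sub>R s"
        by (simp add: k(1) k'(1) algebra_simps)
      then have "N (k - k') \<le> a * N (x - x') + b * N (z - z') + c * \<bar>\<tau> - \<tau>'\<bar>"
        by (simp only: N_sum3)
      also have "\<dots> \<le> a * 4 + b * 2 + c * 2"
        using x z k(4) k'(4) abc by (intro add_mono mult_left_mono) auto
      finally show "N (k - k') \<le> D" by (simp add: D)
    qed
    \<comment> \<open>\<open>v 1\<close> equals 3 a + b + c at \<open>?k\<close> and -(a + b + c) at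
      \<open>?k'\<close>, which differ by D.\<close>
    let ?k = "a *\<^sub>R e 1 + b *\<^sub>R s + (c * 1) *\<^sub>R s" and ?k' = "a *\<^sub>R e 3 + b *\<^sub>R (- s) + (c * (- 1)) *\<^sub>R s"
    have "?k \<in> K" "?k' \<in> K" using N1 by (intro memK eT; simp add: N_minus)+
    then have "N (?k - ?k') \<le> norm_diameter N K" by (rule norm_le_diameter[OF body])
    moreover have "v 1 (?k - ?k') \<le> N (?k - ?k')" using abs_v_le[of 1] by (metis abs_le_D1)
    moreover have "v 1 (?k - ?k') = D"
      unfolding linear_diff[OF lin] v_sum3 by (simp add: linear_neg[OF lin] e y_def s D)
    ultimately show "D \<le> norm_diameter N K" by linarith
  qed
  have inr: "inradius N K = r"
  proof (rule antisym)
    show "inradius N K \<le> r"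
    proof (rule inradius_le[OF body])
      fix \<rho> z assume \<rho>: "0 \<le> \<rho>" "scaled_ball N z \<rho> \<subseteq> K"
      \<comment> \<open>\<open>v 1 + v 3\<close> vanishes on \<open>s\<close>, and the slab it defines touches both \<open>T\<close> and the unit ball\<close>
      have width: "\<bar>v 1 k + v 3 k\<bar> \<le> 2 * r" if kK: "k \<in> K" for k
      proof -
        obtain x z \<tau> where k: "k = a *\<^sub>R x + b *\<^sub>R z + (c * \<tau>) *\<^sub>R s" "x \<in> T" "N z \<le> 1"
          using K_elim[OF kK] by blast
        \<comment> \<open>The upper bound comes from v 1 + v 3 = -(v 2 + v 4).\<close>
        have "\<bar>v 1 x + v 3 x\<bar> \<le> 2" using k(2) s4[of x] by (auto simp: T_def forall_4 abs_le_iff)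
        moreover have "\<bar>v 1 z + v 3 z\<bar> \<le> 2"
          using k(3) abs_v_le[of 1 z] abs_v_le[of 3 z] by linarith
        moreover have "v 1 k + v 3 k = a * (v 1 x + v 3 x) + b * (v 1 z + v 3 z)"
          unfolding k(1) v_sum3 by (simp add: s algebra_simps)
        ultimately have "\<bar>v 1 k + v 3 k\<bar> \<le> a * 2 + b * 2"
          using abc abs_triangle_ineq[of "a * (v 1 x + v 3 x)" "b * (v 1 z + v 3 z)"]
            mult_left_mono[of "\<bar>v 1 x + v 3 x\<bar>" 2 a] mult_left_mono[of "\<bar>v 1 z + v 3 z\<bar>" 2 b]
          by (simp add: abs_mult)
        then show ?thesis by (simp add: r)
      qed
      \<comment> \<open>The values of v 1 + v 3 at these two points differ by 4 \<rho>, and on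
        \<open>K\<close> they vary by at most 4 r.\<close>
      have "z + \<rho> *\<^sub>R m \<in> K" "z + \<rho> *\<^sub>R (- m) \<in> K"
        using scaled_ball_subsetD[OF \<rho>(2)] N1 by (simp_all add: N_minus del: scaleR_minus_right)
      from this[THEN width] show "\<rho> \<le> r"
        by (simp add: linear_add[OF lin] linear_diff[OF lin] linear_neg[OF lin] linear_scale[OF lin] m)
    qed
    have "scaled_ball N 0 (a + b) \<subseteq> K"
    proof -
      \<comment> \<open>The unit ball lies in \<open>T\<close>, so (a + b) x splits as a x + b x
        with one term for each summand.\<close>
      have "0 + (a + b) *\<^sub>R x \<in> K" if "N x \<le> 1" for x
      proof -
        have "x \<in> T" using that unit by (auto simp: T_def abs_le_iff minus_le_iff)
        then show ?thesis using memK[of x x 0] that by (simp add: algebra_simps)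
      qed
      then show ?thesis by (auto simp: scaled_ball_def unit_ball_def)
    qed
    then show "r \<le> inradius N K" using abc by (auto simp: r intro: inradius_ge[OF body])
  qed
  show ?thesis using body circ diam inr by blast
qed

end

section \<open>Cross-polytopes as octahedral unit balls\<close>

text \<open>The l1 ball is convex and contains the generators. Conversely, \<open>x\<close> is a
  convex combination of signed unit vectors with weights \<open>\<bar>x $ i\<bar>\<close>, the
  missing weight going to the origin, indexed by \<open>None\<close>.\<close>

lemma std_cross_polytope_eq: "(std_cross_polytope :: (real^'n) set) = {x. (\<Sum>i\<in>UNIV. \<bar>x $ i\<bar>) \<le> 1}"
proof (intro equalityI subsetI)
  fix x :: "real^'n" assume x: "x \<in> std_cross_polytope"
  have "convex {x :: real^'n. (\<Sum>i\<in>UNIV. \<bar>x $ i\<bar>) \<le> 1}"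
  proof (rule convexI)
    fix x y :: "real^'n" and s t :: real
    assume *: "x \<in> {x. (\<Sum>i\<in>UNIV. \<bar>x $ i\<bar>) \<le> 1}" "y \<in> {x. (\<Sum>i\<in>UNIV. \<bar>x $ i\<bar>) \<le> 1}"
      "0 \<le> s" "0 \<le> t" "s + t = 1"
    have "(\<Sum>i\<in>UNIV. \<bar>(s *\<^sub>R x + t *\<^sub>R y) $ i\<bar>) \<le> (\<Sum>i\<in>UNIV. s * \<bar>x $ i\<bar> + t * \<bar>y $ i\<bar>)"
      using * by (intro sum_mono) (auto intro!: order_trans[OF abs_triangle_ineq] simp: abs_mult)
    also have "\<dots> = s * (\<Sum>i\<in>UNIV. \<bar>x $ i\<bar>) + t * (\<Sum>i\<in>UNIV. \<bar>y $ i\<bar>)"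
      by (simp add: sum.distrib sum_distrib_left)
    also have "\<dots> \<le> s * 1 + t * 1" using * by (intro add_mono mult_left_mono) auto
    finally show "s *\<^sub>R x + t *\<^sub>R y \<in> {x. (\<Sum>i\<in>UNIV. \<bar>x $ i\<bar>) \<le> 1}" using * by simp
  qed
  moreover have "(\<Union>i. {axis i 1, - axis i 1}) \<subseteq> {x :: real^'n. (\<Sum>i\<in>UNIV. \<bar>x $ i\<bar>) \<le> 1}"
    by (auto simp: axis_def if_distrib cong: if_cong)
  ultimately show "x \<in> {x. (\<Sum>i\<in>UNIV. \<bar>x $ i\<bar>) \<le> 1}"
    using x hull_minimal[of _ _ convex] unfolding std_cross_polytope_def by blast
next
  fix x :: "real^'n" assume "x \<in> {x. (\<Sum>i\<in>UNIV. \<bar>x $ i\<bar>) \<le> 1}"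
  then have x: "(\<Sum>i\<in>UNIV. \<bar>x $ i\<bar>) \<le> 1" by simp
  let ?P = "std_cross_polytope :: (real^'n) set"
  have conv: "convex ?P" by (simp add: std_cross_polytope_def)
  have ax: "axis i 1 \<in> ?P" "- axis i 1 \<in> ?P" for i
    unfolding std_cross_polytope_def by (auto intro!: hull_inc)
  have zero: "0 \<in> ?P"
    using convexD[OF conv ax[of undefined], of "1/2" "1/2"] by simp
  have sgn: "sgn (x $ i) *\<^sub>R axis i 1 \<in> ?P" for i
    using ax[of i] zero by (auto simp: sgn_if)
  define w where "w k = (case k of None \<Rightarrow> 1 - (\<Sum>i\<in>UNIV. \<bar>x $ i\<bar>) | Some i \<Rightarrow> \<bar>x $ i\<bar>)" for k
  define p where "p k = (case k of None \<Rightarrow> 0 | Some i \<Rightarrow> sgn (x $ i) *\<^sub>R axis i (1::real))" for k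
  have "(\<Sum>k\<in>UNIV. w k *\<^sub>R p k) \<in> ?P"
  proof (rule convex_sum)
    show "(\<Sum>k\<in>UNIV. w k) = 1"
      by (simp add: UNIV_option_conv sum.reindex w_def)
  qed (use conv x sgn zero in \<open>auto simp: w_def p_def split: option.split\<close>)
  also have "(\<Sum>k\<in>UNIV. w k *\<^sub>R p k) = x"
    by (simp add: UNIV_option_conv sum.reindex w_def p_def vec_eq_iff axis_def abs_mult_sgn
        if_distrib mult_if_delta cong: if_cong)
  finally show "x \<in> ?P" .
qed

text \<open>In the coordinates \<open>L\<close> the unit ball becomes the l1 ball, whose eight
  facets are given by sign patterns; one pattern from each opposite pair gives
  \<open>v\<close>.\<close>

lemma ex_octahedral_norm:
  assumes norm: "is_norm N" and cp: "is_cross_polytope (unit_ball N)"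
  shows "\<exists>v. octahedral_norm N v"
proof -
  obtain A :: "real^3^3" and b where A: "invertible A"
    "unit_ball N = (\<lambda>x. A *v x + b) ` std_cross_polytope"
    using cp unfolding is_cross_polytope_def by blast
  obtain A' where A': "A ** A' = mat 1" "A' ** A = mat 1" using A(1) by (auto simp: invertible_def)
  define L where "L = (*v) A'"
  have AL: "A *v L x = x" and LA: "L (A *v x) = x" for x
    by (simp_all add: L_def matrix_vector_mul_assoc A')
  have lin: "linear L" by (simp add: L_def)
  define l1 where "l1 x = \<bar>x $ 1\<bar> + \<bar>x $ 2\<bar> + \<bar>x $ 3\<bar>" for x :: "real^3"
  have cpl: "x \<in> std_cross_polytope \<longleftrightarrow> l1 x \<le> 1" for x :: "real^3"
    by (simp add: std_cross_polytope_eq l1_def sum_3)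
  have N_iff: "N x \<le> 1 \<longleftrightarrow> l1 (L x - L b) \<le> 1" for x
  proof -
    have "N x \<le> 1 \<longleftrightarrow> x \<in> unit_ball N" by (simp add: unit_ball_def)
    also have "\<dots> \<longleftrightarrow> (\<exists>z. l1 z \<le> 1 \<and> x = A *v z + b)" unfolding A(2) by (auto simp: cpl)
    also have "\<dots> \<longleftrightarrow> l1 (L x - L b) \<le> 1"
    proof
      assume "\<exists>z. l1 z \<le> 1 \<and> x = A *v z + b"
      then show "l1 (L x - L b) \<le> 1" by (auto simp: linear_add[OF lin] LA)
    next
      assume *: "l1 (L x - L b) \<le> 1"
      have "x = A *v (L x - L b) + b" by (simp add: matrix_vector_mult_diff_distrib AL)
      then show "\<exists>z. l1 z \<le> 1 \<and> x = A *v z + b" using * by blast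
    qed
    finally show ?thesis .
  qed
  have N_neg: "N (- x) = N x" for x
  proof -
    have "N ((-1) *\<^sub>R x) = \<bar>-1\<bar> * N x" using norm unfolding is_norm_def by blast
    then show ?thesis by simp
  qed
  \<comment> \<open>Symmetry of the ball forces its centre to be the origin: otherwise the boundary
    point reached from \<open>b\<close> by moving outward along \<open>b\<close> would have its
    negative outside the ball.\<close>
  have "L b = 0"
  proof (rule ccontr)
    assume nz: "L b \<noteq> 0"
    define t where "t = l1 (L b)"
    have scale: "l1 (k *\<^sub>R x) = \<bar>k\<bar> * l1 x" for k x by (simp add: l1_def abs_mult algebra_simps)
    have t: "0 < t" using nz by (auto simp: t_def l1_def vec_eq_iff forall_3)
    define x where "x = A *v ((1 + 1 / t) *\<^sub>R L b)"
    have Lx: "L x = (1 + 1 / t) *\<^sub>R L b" by (simp only: x_def LA)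
    have "L x - L b = (1 / t) *\<^sub>R L b" by (simp add: Lx algebra_simps)
    then have "N x \<le> 1" using t by (simp add: N_iff scale t_def[symmetric])
    then have "l1 (L (- x) - L b) \<le> 1" by (simp add: N_neg flip: N_iff)
    moreover have "L (- x) - L b = (- (2 + 1 / t)) *\<^sub>R L b"
      by (simp add: linear_neg[OF lin] Lx algebra_simps scaleR_2)
    moreover have "\<bar>- (2 + 1 / t)\<bar> * t = 2 * t + 1" using t by (simp add: field_simps)
    ultimately show False using t by (simp only: scale t_def[symmetric])
  qed
  then have N_iff': "N x \<le> 1 \<longleftrightarrow> l1 (L x) \<le> 1" for x by (simp add: N_iff)
  \<comment> \<open>The patterns with an even number of minus signs: one from each opposite pair,
    with vanishing sum.\<close>
  define v :: "4 \<Rightarrow> real^3 \<Rightarrow> real" where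
    "v i x = (if i = 1 then L x $ 1 + L x $ 2 + L x $ 3
              else if i = 2 then L x $ 1 - L x $ 2 - L x $ 3
              else if i = 3 then - L x $ 1 + L x $ 2 - L x $ 3
              else - L x $ 1 - L x $ 2 + L x $ 3)" for i x
  have "octahedral_norm N v"
  proof (rule octahedral_norm.intro)
    show "is_norm N" by (rule norm)
    show "linear (v i)" for i
      by (rule linearI) (auto simp: v_def linear_add[OF lin] linear_scale[OF lin] algebra_simps)
    show "(\<Sum>i\<in>UNIV. v i x) = 0" for x by (simp add: sum_4 v_def)
    show "N x \<le> 1 \<longleftrightarrow> (\<forall>i. \<bar>v i x\<bar> \<le> 1)" for x
      unfolding N_iff' l1_def by (simp add: forall_4 v_def) (smt (verit))
    show "\<exists>x. \<forall>i. v i x = y i" if "(\<Sum>i\<in>UNIV. y i) = 0" for y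
    proof -
      \<comment> \<open>v 1 + v 2, v 1 + v 3 and v 1 + v 4 are twice the three coordinates.\<close>
      let ?z = "vector [(y 1 + y 2) / 2, (y 1 + y 3) / 2, (y 1 + y 4) / 2] :: real^3"
      have "\<forall>i. v i (A *v ?z) = y i"
        using that by (simp add: forall_4 v_def LA sum_4 field_simps)
      then show ?thesis ..
    qed
    have "compact (std_cross_polytope :: (real^3) set)"
      unfolding std_cross_polytope_def by (intro compact_convex_hull finite_imp_compact) auto
    then show "compact (unit_ball N)" unfolding A(2)
      by (intro compact_continuous_image continuous_intros matrix_vector_mult_linear_continuous_on)
  qed
  then show ?thesis by blast
qed

theorem theorem1p2:
  fixes N :: "real^3 \<Rightarrow> real"
  assumes "is_norm N"
    and "is_cross_polytope (unit_ball N)"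
  shows "(\<forall>K. convex_body K \<longrightarrow>
            norm_diameter N K \<le> 2 * circumradius N K \<and>
            inradius N K + circumradius N K \<le> norm_diameter N K \<and>
            2 * (circumradius N K - inradius N K) \<le> norm_diameter N K) \<and>
         (\<forall>r D R :: real. D \<le> 2 * R \<and> r + R \<le> D \<and> 2 * (R - r) \<le> D \<longrightarrow>
            (\<exists>K. convex_body K \<and>
                 inradius N K = r \<and> norm_diameter N K = D \<and> circumradius N K = R))"
proof -
  obtain v where "octahedral_norm N v" using ex_octahedral_norm[OF assms] ..
  then interpret octahedral_norm N v .
  show ?thesis
    using diameter_le_circumradius inradius_circumradius_le circumradius_minus_inradius_le ex_body
    by blast
qed

end
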